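(* Let $R$ be a NIP ring and let $I$ be a radical ideal of $R$. Then $I$ is externally definable.
   Context: All rings are commutative and unital. A ring is NIP if its complete theory in the language of rings is NIP. A subset $D\subseteq R^n$ is externally definable if $D=\phi(R,b)$ for some formula $\phi(x,y)$ in the language of rings (with parameters from $R$) and some tuple $b$ from an elementary extension of $R$. *)

theory Defs
  imports "HOL-Algebra.Ideal"
begin

datatype rterm =
  TVar nat | TZero | TOne | TUminus rterm | TPlus rterm rterm | TTimes rterm rterm

datatype rform =
  FEq rterm rterm | FNot rform | FAnd rform rform | FEx nat rform

primrec tvars :: "rterm \<Rightarrow> nat set" where
  "tvars (TVar i) = {i}"
| "tvars TZero = {}"
| "tvars TOne = {}"
| "tvars (TUminus s) = tvars s"
| "tvars (TPlus s t) = tvars s \<union> tvars t"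
| "tvars (TTimes s t) = tvars s \<union> tvars t"

primrec fvars :: "rform \<Rightarrow> nat set" where
  "fvars (FEq s t) = tvars s \<union> tvars t"
| "fvars (FNot f) = fvars f"
| "fvars (FAnd f g) = fvars f \<union> fvars g"
| "fvars (FEx i f) = fvars f - {i}"

primrec tval :: "('a, 'm) ring_scheme \<Rightarrow> (nat \<Rightarrow> 'a) \<Rightarrow> rterm \<Rightarrow> 'a" where
  "tval M v (TVar i) = v i"
| "tval M v TZero = \<zero>\<^bsub>M\<^esub>"
| "tval M v TOne = \<one>\<^bsub>M\<^esub>"
| "tval M v (TUminus s) = \<ominus>\<^bsub>M\<^esub> tval M v s"
| "tval M v (TPlus s t) = tval M v s \<oplus>\<^bsub>M\<^esub> tval M v t"
| "tval M v (TTimes s t) = tval M v s \<otimes>\<^bsub>M\<^esub> tval M v t"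

primrec sat :: "('a, 'm) ring_scheme \<Rightarrow> (nat \<Rightarrow> 'a) \<Rightarrow> rform \<Rightarrow> bool" where
  "sat M v (FEq s t) \<longleftrightarrow> tval M v s = tval M v t"
| "sat M v (FNot f) \<longleftrightarrow> \<not> sat M v f"
| "sat M v (FAnd f g) \<longleftrightarrow> sat M v f \<and> sat M v g"
| "sat M v (FEx i f) \<longleftrightarrow> (\<exists>a\<in>carrier M. sat M (v(i := a)) f)"

definition tuples :: "'a set \<Rightarrow> nat \<Rightarrow> 'a list set" where
  "tuples X n = {a. length a = n \<and> set a \<subseteq> X}"

text \<open>A tuple \<open>a\<close> is plugged into a formula by the assignment \<open>(!) a\<close>, so a formula in the
  variables \<open>(x, y)\<close> with \<open>length x = n\<close> and \<open>length y = m\<close> is one whose free variables are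
  among \<open>0, \<dots>, n + m - 1\<close>, and it is evaluated at \<open>(!) (a @ b)\<close>.  The values of the
  assignment beyond the length of the list are irrelevant.\<close>

definition holds :: "('a, 'm) ring_scheme \<Rightarrow> rform \<Rightarrow> bool" where
  "holds M f \<longleftrightarrow> (\<forall>v. range v \<subseteq> carrier M \<longrightarrow> sat M v f)"

definition complete_theory :: "('a, 'm) ring_scheme \<Rightarrow> rform set" where
  "complete_theory M = {f. fvars f = {} \<and> holds M f}"

definition ring_model :: "('a, 'm) ring_scheme \<Rightarrow> rform set \<Rightarrow> bool" where
  "ring_model M T \<longleftrightarrow> cring M \<and> (\<forall>f\<in>T. holds M f)"

definition shatters :: "('a, 'm) ring_scheme \<Rightarrow> rform \<Rightarrow> nat \<Rightarrow> nat \<Rightarrow> 'a list set \<Rightarrow> bool" where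
  "shatters M f n m A \<longleftrightarrow> A \<subseteq> tuples (carrier M) n \<and>
     (\<forall>B\<subseteq>A. \<exists>b\<in>tuples (carrier M) m. \<forall>a\<in>A. sat M ((!) (a @ b)) f \<longleftrightarrow> a \<in> B)"

text \<open>The independence property: the formula \<open>f(x; y)\<close> shatters arbitrarily large finite sets in
  models of \<open>T\<close>.  For each \<open>k\<close>, that some set of size \<open>k\<close> is shattered is expressed by one
  first-order sentence.  Hence, if \<open>T\<close> is the complete theory of a ring with elements in \<open>'a\<close>,
  all models of \<open>T\<close> agree on it, and nothing is lost by taking only models with elements in
  \<open>'a\<close> (the ring itself being one) or by requiring some model rather than every model.\<close>

definition has_IP :: "'a itself \<Rightarrow> rform set \<Rightarrow> rform \<Rightarrow> nat \<Rightarrow> nat \<Rightarrow> bool" where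
  "has_IP (_ :: 'a itself) T f n m \<longleftrightarrow>
     (\<forall>k. \<exists>M :: 'a ring. ring_model M T \<and> (\<exists>A. finite A \<and> card A = k \<and> shatters M f n m A))"

definition NIP_theory :: "'a itself \<Rightarrow> rform set \<Rightarrow> bool" where
  "NIP_theory (U :: 'a itself) T \<longleftrightarrow>
     (\<forall>f n m. fvars f \<subseteq> {..<n + m} \<longrightarrow> \<not> has_IP U T f n m)"

definition NIP_ring :: "'a ring \<Rightarrow> bool" where
  "NIP_ring R \<longleftrightarrow> cring R \<and> NIP_theory TYPE('a) (complete_theory R)"

text \<open>\<open>S\<close> is an elementary extension of \<open>R\<close>, where \<open>R\<close> is identified with its image under
  the (automatically injective) map \<open>h\<close>.\<close>

definition elementary_extension ::
    "('a, 'm) ring_scheme \<Rightarrow> ('b, 'k) ring_scheme \<Rightarrow> ('a \<Rightarrow> 'b) \<Rightarrow> bool" where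
  "elementary_extension R S h \<longleftrightarrow> cring S \<and> h \<in> carrier R \<rightarrow> carrier S \<and>
     (\<forall>f v. range v \<subseteq> carrier R \<longrightarrow> (sat R v f \<longleftrightarrow> sat S (h \<circ> v) f))"

text \<open>\<open>D = f(R, b, c)\<close> with \<open>b\<close> from an elementary extension and parameters \<open>c\<close> from \<open>R\<close>.
  HOL cannot quantify over the type of the elements of the extension, so a type that is large
  enough is fixed: by downward Loewenheim-Skolem, an extension containing \<open>b\<close> can be chosen of
  cardinality at most that of \<open>R\<close> if \<open>R\<close> is infinite, and is isomorphic to \<open>R\<close> if \<open>R\<close> is
  finite.  The type below, which is at least as large as \<open>'a\<close>, also has room for the ultrapowers
  of \<open>R\<close> over the finite subsets of \<open>R\<close>.\<close>

definition externally_definable :: "'a ring \<Rightarrow> nat \<Rightarrow> 'a list set \<Rightarrow> bool" where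
  "externally_definable R n D \<longleftrightarrow>
     (\<exists>(S :: ('a set \<Rightarrow> 'a) ring) h f m p. \<exists>b\<in>tuples (carrier S) m. \<exists>c\<in>tuples (carrier R) p.
        elementary_extension R S h \<and> fvars f \<subseteq> {..<n + m + p} \<and>
        D = {a \<in> tuples (carrier R) n. sat S ((!) (map h a @ b @ map h c)) f})"

definition radical :: "('a, 'm) ring_scheme \<Rightarrow> 'a set \<Rightarrow> 'a set" where
  "radical R I = {x \<in> carrier R. \<exists>k::nat. k \<ge> 1 \<and> x [^]\<^bsub>R\<^esub> k \<in> I}"

definition radical_ideal :: "'a set \<Rightarrow> ('a, 'm) ring_scheme \<Rightarrow> bool" where
  "radical_ideal I R \<longleftrightarrow> ideal I R \<and> radical R I = I"

end

theory Submission
  imports Defs "HOL-Algebra.Divisibility"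
begin

text \<open>
  Cover a finite set \<open>F\<close> disjoint from \<open>I\<close> by elements \<open>b\<^sub>1, \<dots>, b\<^sub>m\<close> outside \<open>I\<close>, in the sense
  that every member of \<open>F\<close> divides some \<open>b\<^sub>i\<close>, and take \<open>m\<close> minimal.  Then \<open>b\<^sub>i b\<^sub>j \<in> I\<close> for
  \<open>i \<noteq> j\<close>, as otherwise \<open>b\<^sub>i b\<^sub>j\<close> could replace both.  Put \<open>d\<^sub>i = \<Sum>\<^bsub>j \<noteq> i\<^esub> b\<^sub>j\<close>.  Since
  \<open>b\<^sub>i d\<^sub>i \<in> I\<close> and \<open>b\<^sub>i d\<^sub>j \<equiv> b\<^sub>i\<^sup>2\<close> modulo \<open>I\<close> for \<open>j \<noteq> i\<close>, and \<open>I\<close> is radical, \<open>d\<^sub>i\<close> divides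
  \<open>\<Prod>\<^bsub>j \<in> J\<^esub> d\<^sub>j\<close> iff \<open>i \<in> J\<close>: the divisibility formula shatters a set of size \<open>m\<close>, so NIP bounds
  \<open>m\<close> by some \<open>k\<close> independent of \<open>F\<close>.  As divisors of elements outside \<open>I\<close> lie outside \<open>I\<close>, the
  formula ``\<open>x\<close> divides none of \<open>y\<^sub>1, \<dots>, y\<^sub>k\<close>'' cuts out \<open>I\<close> on any finite set, for suitable \<open>y\<close>
  in \<open>R\<close>.  An ultrapower over the finite subsets of \<open>R\<close> yields one \<open>y\<close> that works everywhere.
\<close>

section \<open>Ultrapowers\<close>

text \<open>A finer filter has more eventual predicates, so Zorn's lemma for inclusion, applied to
  the sets \<open>ev G\<close>, yields a minimal proper filter below \<open>F\<close>.\<close>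

lemma ultrafilter_exists:
  fixes F :: "'i filter"
  assumes "F \<noteq> bot"
  obtains U where "U \<le> F" "U \<noteq> bot" "\<And>P. eventually P U \<or> eventually (\<lambda>i. \<not> P i) U"
proof -
  define ev where "ev G = {P. eventually P G}" for G :: "'i filter"
  have ev_mono: "ev G \<subseteq> ev H \<longleftrightarrow> H \<le> G" for G H
    by (auto simp: ev_def le_filter_def)
  define \<A> where "\<A> = ev ` {G. G \<noteq> bot \<and> G \<le> F}"
  have "\<exists>M\<in>\<A>. \<forall>X\<in>\<A>. M \<subseteq> X \<longrightarrow> X = M"
  proof (rule subset_Zorn_nonempty)
    show "\<A> \<noteq> {}" using assms by (auto simp: \<A>_def)
  next
    fix \<C> assume ne: "\<C> \<noteq> {}" and ch: "subset.chain \<A> \<C>"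
    define \<G> where "\<G> = {G. G \<noteq> bot \<and> G \<le> F \<and> ev G \<in> \<C>}"
    have C: "\<C> = ev ` \<G>"
      using ch by (auto simp: \<G>_def \<A>_def subset.chain_def)
    \<comment> \<open>A chain is downward directed, so a predicate is eventual for the infimum iff
      it is so for some member; in particular the infimum stays proper.\<close>
    have "\<exists>K\<in>\<G>. K \<le> inf G H" if "G \<in> \<G>" "H \<in> \<G>" for G H
    proof -
      have "ev G \<in> \<C>" "ev H \<in> \<C>" using that C by auto
      then have "ev G \<subseteq> ev H \<or> ev H \<subseteq> ev G"
        using ch unfolding subset.chain_def by blast
      then have "G \<le> H \<or> H \<le> G" by (auto simp: ev_mono)
      then show ?thesis using that by auto
    qed
    moreover have "\<G> \<noteq> {}" using ne C by auto
    ultimately have Inf: "eventually P (Inf \<G>) \<longleftrightarrow> (\<exists>G\<in>\<G>. eventually P G)" for P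
      by (intro eventually_Inf_base) auto
    then have "\<Union>\<C> = ev (Inf \<G>)" by (auto simp: C ev_def)
    moreover have "Inf \<G> \<noteq> bot"
      unfolding trivial_limit_def Inf by (auto simp: \<G>_def trivial_limit_def)
    moreover have "Inf \<G> \<le> F"
      using \<open>\<G> \<noteq> {}\<close> by (auto simp: \<G>_def intro: Inf_lower2)
    ultimately show "\<Union>\<C> \<in> \<A>" by (auto simp: \<A>_def)
  qed
  then obtain M where M: "M \<in> \<A>" and M_max: "\<And>X. X \<in> \<A> \<Longrightarrow> M \<subseteq> X \<Longrightarrow> X = M"
    by blast
  from M obtain U where U: "U \<noteq> bot" "U \<le> F" and "M = ev U"
    by (auto simp: \<A>_def)
  have max: "U \<le> G" if "G \<noteq> bot" "G \<le> F" "G \<le> U" for G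
  proof -
    have "ev G \<in> \<A>" using that by (auto simp: \<A>_def)
    then have "ev G = ev U" using M_max \<open>M = ev U\<close> that(3) by (simp add: ev_mono)
    then show ?thesis by (simp flip: ev_mono)
  qed
  have "eventually P U \<or> eventually (\<lambda>i. \<not> P i) U" for P
  proof (rule disjCI)
    assume "\<not> eventually (\<lambda>i. \<not> P i) U"
    \<comment> \<open>Restricting \<open>U\<close> to \<open>P\<close> keeps it proper, so
      minimality of \<open>U\<close> forces \<open>P\<close> to be eventual already.\<close>
    let ?G = "inf U (principal {i. P i})"
    have "?G \<noteq> bot"
      using \<open>\<not> eventually (\<lambda>i. \<not> P i) U\<close> by (simp add: trivial_limit_def eventually_inf_principal)
    then have "U \<le> ?G" using U by (intro max) (auto intro: le_infI1)
    then have "U \<le> principal {i. P i}" by simp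
    then show "eventually P U" by (simp add: le_principal)
  qed
  with U show thesis using that by blast
qed

locale ultrapower = cring R for R :: "'a ring" (structure) +
  fixes U :: "'i filter"
  assumes U_proper: "U \<noteq> bot"
    and U_ultra: "eventually P U \<or> eventually (\<lambda>i. \<not> P i) U"
begin

lemma eventually_not_ultra: "eventually (\<lambda>i. \<not> P i) U \<longleftrightarrow> \<not> eventually P U"
proof
  assume neg: "eventually (\<lambda>i. \<not> P i) U"
  show "\<not> eventually P U"
  proof
    assume "eventually P U"
    with neg have "eventually (\<lambda>_. False) U" by eventually_elim simp
    then show False using U_proper by (simp add: trivial_limit_def)
  qed
qed (use U_ultra in blast)

definition families :: "('i \<Rightarrow> 'a) set"
  where "families = {f. \<forall>i. f i \<in> carrier R}"

lemma familiesD: "f \<in> families \<Longrightarrow> f i \<in> carrier R"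
  by (simp add: families_def)

text \<open>Elements of the ultrapower are represented by chosen members of the classes modulo \<open>U\<close>, so
  that they are again functions of type \<^typ>\<open>'i \<Rightarrow> 'a\<close>.\<close>

definition rep :: "('i \<Rightarrow> 'a) \<Rightarrow> 'i \<Rightarrow> 'a"
  where "rep f = (SOME g. g \<in> families \<and> eventually (\<lambda>i. g i = f i) U)"

lemma rep:
  assumes "f \<in> families"
  shows "rep f \<in> families" "eventually (\<lambda>i. rep f i = f i) U"
proof -
  have "rep f \<in> families \<and> eventually (\<lambda>i. rep f i = f i) U"
    unfolding rep_def by (rule someI[of _ f]) (use assms in simp)
  then show "rep f \<in> families" "eventually (\<lambda>i. rep f i = f i) U" by auto
qed

text \<open>Families that agree almost everywhere satisfy the same choice predicate, so
  \<open>SOME\<close> picks literally the same representative.\<close>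

lemma rep_eqI:
  assumes "eventually (\<lambda>i. f i = g i) U"
  shows "rep f = rep g"
proof -
  have "eventually (\<lambda>i. h i = f i) U \<longleftrightarrow> eventually (\<lambda>i. h i = g i) U" for h
    by (rule eventually_cong[OF assms]) simp
  then show ?thesis by (simp add: rep_def)
qed

lemma rep_eq_iff:
  assumes "f \<in> families" "g \<in> families"
  shows "rep f = rep g \<longleftrightarrow> eventually (\<lambda>i. f i = g i) U"
proof
  assume "rep f = rep g"
  then have "eventually (\<lambda>i. rep f i = g i) U" using rep[OF assms(2)] by simp
  with rep(2)[OF assms(1)] show "eventually (\<lambda>i. f i = g i) U"
    by eventually_elim simp
qed (rule rep_eqI)

definition upow :: "('i \<Rightarrow> 'a) ring" where
  "upow = \<lparr>carrier = rep ` families, monoid.mult = (\<lambda>f g. rep (\<lambda>i. f i \<otimes> g i)), one = rep (\<lambda>_. \<one>),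
           zero = rep (\<lambda>_. \<zero>), add = (\<lambda>f g. rep (\<lambda>i. f i \<oplus> g i))\<rparr>"

lemma carrier_upow: "carrier upow = rep ` families"
  and one_upow: "\<one>\<^bsub>upow\<^esub> = rep (\<lambda>_. \<one>)"
  and zero_upow: "\<zero>\<^bsub>upow\<^esub> = rep (\<lambda>_. \<zero>)"
  by (simp_all add: upow_def)

lemma mult_upow:
  assumes "f \<in> families" "g \<in> families"
  shows "rep f \<otimes>\<^bsub>upow\<^esub> rep g = rep (\<lambda>i. f i \<otimes> g i)"
proof -
  have "eventually (\<lambda>i. rep f i \<otimes> rep g i = f i \<otimes> g i) U"
    using rep(2)[OF assms(1)] rep(2)[OF assms(2)] by eventually_elim simp
  then show ?thesis by (simp add: upow_def rep_eqI)
qed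

lemma add_upow:
  assumes "f \<in> families" "g \<in> families"
  shows "rep f \<oplus>\<^bsub>upow\<^esub> rep g = rep (\<lambda>i. f i \<oplus> g i)"
proof -
  have "eventually (\<lambda>i. rep f i \<oplus> rep g i = f i \<oplus> g i) U"
    using rep(2)[OF assms(1)] rep(2)[OF assms(2)] by eventually_elim simp
  then show ?thesis by (simp add: upow_def rep_eqI)
qed

lemma families_closed [simp]:
  "(\<lambda>_. \<zero>) \<in> families" "(\<lambda>_. \<one>) \<in> families"
  "f \<in> families \<Longrightarrow> (\<lambda>i. \<ominus> f i) \<in> families"
  "f \<in> families \<Longrightarrow> g \<in> families \<Longrightarrow> (\<lambda>i. f i \<oplus> g i) \<in> families"
  "f \<in> families \<Longrightarrow> g \<in> families \<Longrightarrow> (\<lambda>i. f i \<otimes> g i) \<in> families"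
  by (simp_all add: families_def)

lemma l_neg_upow:
  assumes "f \<in> families"
  shows "rep (\<lambda>i. \<ominus> f i) \<oplus>\<^bsub>upow\<^esub> rep f = \<zero>\<^bsub>upow\<^esub>"
  using assms by (simp add: add_upow zero_upow l_neg familiesD)

lemma cring_upow: "cring upow"
proof (rule cringI)
  show "abelian_group upow"
  proof (rule abelian_groupI)
    show "\<exists>y\<in>carrier upow. y \<oplus>\<^bsub>upow\<^esub> x = \<zero>\<^bsub>upow\<^esub>" if x: "x \<in> carrier upow" for x
    proof -
      obtain f where "x = rep f" "f \<in> families" using x by (auto simp: carrier_upow)
      then show ?thesis
        by (intro bexI[of _ "rep (\<lambda>i. \<ominus> f i)"]) (auto simp: l_neg_upow carrier_upow)
    qed
  qed (auto simp: carrier_upow add_upow zero_upow familiesD a_ac)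
  show "comm_monoid upow"
    by (rule comm_monoidI)
      (auto simp: carrier_upow mult_upow one_upow familiesD m_ac)
qed (auto simp: carrier_upow add_upow mult_upow familiesD l_distr)

lemma uminus_upow:
  assumes "f \<in> families"
  shows "\<ominus>\<^bsub>upow\<^esub> rep f = rep (\<lambda>i. \<ominus> f i)"
proof -
  interpret S: cring upow by (rule cring_upow)
  show ?thesis
    using assms by (intro S.minus_equality l_neg_upow) (auto simp: carrier_upow)
qed

lemma tval_upow:
  assumes "\<And>j. v j \<in> families"
  shows "(\<lambda>i. tval R (\<lambda>j. v j i) t) \<in> families \<and>
    tval upow (\<lambda>j. rep (v j)) t = rep (\<lambda>i. tval R (\<lambda>j. v j i) t)"
  using assms
  by (induction t) (simp_all add: zero_upow one_upow uminus_upow add_upow mult_upow)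

text \<open>Induction on the formula: negation uses the ultrafilter dichotomy, and the quantifier
  chooses a witness at each index.\<close>

theorem Los:
  assumes "\<And>j. v j \<in> families"
  shows "sat upow (\<lambda>j. rep (v j)) f \<longleftrightarrow> eventually (\<lambda>i. sat R (\<lambda>j. v j i) f) U"
  using assms
proof (induction f arbitrary: v)
  case (FEq s t)
  then show ?case by (simp add: tval_upow rep_eq_iff)
next
  case (FNot f)
  then show ?case by (simp add: eventually_not_ultra)
next
  case (FAnd f g)
  then show ?case by (simp add: eventually_conj_iff)
next
  case (FEx x f)
  have step: "sat upow ((\<lambda>j. rep (v j))(x := rep g)) f \<longleftrightarrow>
      eventually (\<lambda>i. sat R ((\<lambda>j. v j i)(x := g i)) f) U" if "g \<in> families" for g
  proof -
    have "(\<lambda>j. rep ((v(x := g)) j)) = (\<lambda>j. rep (v j))(x := rep g)"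
      and "\<And>i. (\<lambda>j. (v(x := g)) j i) = (\<lambda>j. v j i)(x := g i)" by auto
    then show ?thesis using FEx.IH[of "v(x := g)"] FEx.prems that by simp
  qed
  show ?case
  proof
    assume "sat upow (\<lambda>j. rep (v j)) (FEx x f)"
    then obtain g where g: "g \<in> families"
      and "eventually (\<lambda>i. sat R ((\<lambda>j. v j i)(x := g i)) f) U"
      by (auto simp: carrier_upow step)
    then show "eventually (\<lambda>i. sat R (\<lambda>j. v j i) (FEx x f)) U"
      by (auto elim!: eventually_mono dest: familiesD)
  next
    assume ev: "eventually (\<lambda>i. sat R (\<lambda>j. v j i) (FEx x f)) U"
    define P where "P i a \<longleftrightarrow> a \<in> carrier R \<and> sat R ((\<lambda>j. v j i)(x := a)) f" for i a
    \<comment> \<open>The default zero keeps \<open>g\<close> a family at the indices without a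
      witness.\<close>
    define g where "g i = (if Ex (P i) then Eps (P i) else \<zero>)" for i
    have P: "P i (g i)" if "P i a" for i a
      using that by (auto simp: g_def intro: someI)
    have "g i \<in> carrier R" for i
    proof (cases "Ex (P i)")
      case True
      then have "P i (g i)" using P by blast
      then show ?thesis by (simp add: P_def)
    qed (auto simp: g_def)
    then have g: "g \<in> families" by (simp add: families_def)
    have "eventually (\<lambda>i. sat R ((\<lambda>j. v j i)(x := g i)) f) U"
      using ev by (rule eventually_mono) (use P in \<open>auto simp: P_def\<close>)
    with g show "sat upow (\<lambda>j. rep (v j)) (FEx x f)"
      by (auto simp: carrier_upow step)
  qed
qed

lemma elementary_extension_upow: "elementary_extension R upow (\<lambda>a. rep (\<lambda>_. a))"
  unfolding elementary_extension_def
proof (intro conjI allI impI cring_upow)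
  show "(\<lambda>a. rep (\<lambda>_. a)) \<in> carrier R \<rightarrow> carrier upow"
    by (auto simp: carrier_upow families_def)
next
  fix f and v :: "nat \<Rightarrow> 'a" assume "range v \<subseteq> carrier R"
  then have "(\<lambda>_. v j) \<in> families" for j by (auto simp: families_def)
  then show "sat R v f \<longleftrightarrow> sat upow ((\<lambda>a. rep (\<lambda>_. a)) \<circ> v) f"
    using Los[of "\<lambda>j _. v j" f] U_proper by (simp add: o_def)
qed

end

section \<open>External definability from uniform local definability\<close>

lemma tval_cong: "(\<And>j. j \<in> tvars t \<Longrightarrow> v j = w j) \<Longrightarrow> tval M v t = tval M w t"
  by (induction t) auto

text \<open>Lets assignments \<open>(!) a\<close> be exchanged for others, since their values beyond
  the length of \<open>a\<close> are unspecified.\<close>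

lemma sat_cong: "(\<And>j. j \<in> fvars f \<Longrightarrow> v j = w j) \<Longrightarrow> sat M v f \<longleftrightarrow> sat M w f"
proof (induction f arbitrary: v w)
  case (FEq s t)
  then have "tval M v s = tval M w s" "tval M v t = tval M w t"
    by (auto intro: tval_cong)
  then show ?case by simp
next
  case (FNot f)
  have "sat M v f \<longleftrightarrow> sat M w f"
    by (rule FNot.IH) (use FNot.prems in auto)
  then show ?case by simp
next
  case (FAnd f g)
  have "sat M v f \<longleftrightarrow> sat M w f"
    by (rule FAnd.IH(1)) (use FAnd.prems in auto)
  moreover have "sat M v g \<longleftrightarrow> sat M w g"
    by (rule FAnd.IH(2)) (use FAnd.prems in auto)
  ultimately show ?case by simp
next
  case (FEx x f)
  have "sat M (v(x := a)) f \<longleftrightarrow> sat M (w(x := a)) f" for a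
    by (rule FEx.IH) (use FEx.prems in auto)
  then show ?case by simp
qed

text \<open>Compactness by ultrapower: the indices are the sets \<open>X\<close>, and the class of
  the local parameters \<open>b X\<close> decides membership in \<open>D\<close> for all tuples at
  once.\<close>

lemma externally_definableI:
  fixes R :: "'a ring"
  assumes R: "cring R"
    and f: "fvars f \<subseteq> {..<n + m}"
    and D: "D \<subseteq> tuples (carrier R) n"
    and loc: "\<And>X. finite X \<Longrightarrow> X \<subseteq> carrier R \<Longrightarrow>
      \<exists>b\<in>tuples (carrier R) m. \<forall>a\<in>tuples X n. sat R ((!) (a @ b)) f \<longleftrightarrow> a \<in> D"
  shows "externally_definable R n D"
proof -
  interpret cring R by fact
  obtain U :: "'a set filter" where U: "U \<le> finite_subsets_at_top (carrier R)" "U \<noteq> bot"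
    "\<And>P. eventually P U \<or> eventually (\<lambda>i. \<not> P i) U"
    using ultrafilter_exists[of "finite_subsets_at_top (carrier R)"] by auto
  interpret ultrapower R U
    by unfold_locales (use U in auto)
  let ?h = "\<lambda>a. rep (\<lambda>_. a)"
  obtain b where b0: "\<And>X. finite X \<Longrightarrow> X \<subseteq> carrier R \<Longrightarrow> b X \<in> tuples (carrier R) m \<and>
      (\<forall>a\<in>tuples X n. sat R ((!) (a @ b X)) f \<longleftrightarrow> a \<in> D)"
    using loc by metis
  \<comment> \<open>One family per coordinate; indices that are not finite subsets of the carrier
    get a dummy zero.\<close>
  define b' where "b' j X = (if finite X \<and> X \<subseteq> carrier R \<and> j < m then b X ! j else \<zero>\<^bsub>R\<^esub>)" for j X
  have b': "b' j \<in> families" for j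
  proof -
    have "b' j X \<in> carrier R" for X
      using b0[of X] by (auto simp: b'_def tuples_def intro: subsetD[OF _ nth_mem])
    then show ?thesis by (simp add: families_def)
  qed
  let ?b = "map (\<lambda>j. rep (b' j)) [0..<m]"
  have b: "?b \<in> tuples (carrier upow) m"
    using b' by (auto simp: tuples_def carrier_upow)
  have "sat upow ((!) (map ?h a @ ?b)) f \<longleftrightarrow> a \<in> D" if a: "a \<in> tuples (carrier R) n" for a
  proof -
    have len: "length a = n" and aR: "set a \<subseteq> carrier R" using a by (auto simp: tuples_def)
    define v where "v j X = (if j < n then a ! j else b' (j - n) X)" for j X
    have v: "v j \<in> families" for j
    proof (cases "j < n")
      case True
      then show ?thesis using aR len by (auto simp: v_def families_def)
    next
      case False
      then show ?thesis using b' by (simp add: v_def families_def)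
    qed
    have "sat upow ((!) (map ?h a @ ?b)) f \<longleftrightarrow> sat upow (\<lambda>j. rep (v j)) f"
    proof (rule sat_cong)
      fix j assume "j \<in> fvars f"
      then have "j < n + m" using f by auto
      then show "(map ?h a @ ?b) ! j = rep (v j)"
      proof (cases "j < n")
        case True
        then have "v j = (\<lambda>_. a ! j)" by (auto simp: v_def)
        then show ?thesis using True len by (simp add: nth_append)
      next
        case False
        then have "v j = b' (j - n)" by (auto simp: v_def)
        moreover have "j - n < m" using False \<open>j < n + m\<close> by linarith
        ultimately show ?thesis using False len by (simp add: nth_append)
      qed
    qed
    also have "\<dots> \<longleftrightarrow> eventually (\<lambda>X. sat R (\<lambda>j. v j X) f) U"
      by (rule Los) (rule v)
    also have "\<dots> \<longleftrightarrow> eventually (\<lambda>X. a \<in> D) U"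
    proof (rule eventually_cong)
      \<comment> \<open>Almost every \<open>X\<close> contains the entries of \<open>a\<close>, and
        for such \<open>X\<close> the parameters \<open>b X\<close> are correct at
        \<open>a\<close>.\<close>
      show "eventually (\<lambda>X. finite X \<and> set a \<subseteq> X \<and> X \<subseteq> carrier R) U"
        by (rule filter_leD[OF U(1)])
          (use aR in \<open>auto simp: eventually_finite_subsets_at_top intro!: exI[of _ "set a"]\<close>)
    next
      fix X assume X: "finite X \<and> set a \<subseteq> X \<and> X \<subseteq> carrier R"
      then have bX: "length (b X) = m" and "sat R ((!) (a @ b X)) f \<longleftrightarrow> a \<in> D"
        using b0[of X] len by (auto simp: tuples_def)
      moreover have "sat R (\<lambda>j. v j X) f \<longleftrightarrow> sat R ((!) (a @ b X)) f"
      proof (rule sat_cong)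
        fix j assume "j \<in> fvars f"
        then have "j < n + m" using f by auto
        then show "v j X = (a @ b X) ! j"
          using len bX X by (auto simp: nth_append v_def b'_def)
      qed
      ultimately show "sat R (\<lambda>j. v j X) f \<longleftrightarrow> a \<in> D" by simp
    qed
    finally show ?thesis using U(2) by simp
  qed
  then have D_eq: "D = {a \<in> tuples (carrier R) n. sat upow ((!) (map ?h a @ ?b @ map ?h [])) f}"
    using D by auto
  show ?thesis
    unfolding externally_definable_def
    by (intro exI[of _ upow] exI[of _ ?h] exI[of _ f] exI[of _ m] exI[of _ 0] bexI[of _ ?b]
        bexI[of _ "[]"] conjI D_eq b elementary_extension_upow)
      (use f in \<open>simp_all add: tuples_def\<close>)
qed

section \<open>Divisibility and radical ideals\<close>

text \<open>The bound variable \<open>z\<close> holds the cofactor and must differ from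
  \<open>i\<close> and \<open>j\<close> to avoid capture.\<close>

definition dvd_form :: "nat \<Rightarrow> nat \<Rightarrow> nat \<Rightarrow> rform"
  where "dvd_form z i j = FEx z (FEq (TVar j) (TTimes (TVar i) (TVar z)))"

lemma sat_dvd_form: "i \<noteq> z \<Longrightarrow> j \<noteq> z \<Longrightarrow> sat M v (dvd_form z i j) \<longleftrightarrow> v i divides\<^bsub>M\<^esub> v j"
  by (simp add: dvd_form_def factor_def)

lemma fvars_dvd_form: "fvars (dvd_form z i j) = {i, j} - {z}"
  by (auto simp: dvd_form_def)

text \<open>Variable 0 is the tested element and variables 1 to \<open>k\<close> are the parameters;
  the trivial equation is the empty conjunction.\<close>

primrec dvd_none :: "nat \<Rightarrow> nat \<Rightarrow> rform" where
  "dvd_none z 0 = FEq TZero TZero"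
| "dvd_none z (Suc k) = FAnd (dvd_none z k) (FNot (dvd_form z 0 (Suc k)))"

lemma sat_dvd_none: "k < z \<Longrightarrow> sat M v (dvd_none z k) \<longleftrightarrow> (\<forall>j\<in>{1..k}. \<not> v 0 divides\<^bsub>M\<^esub> v j)"
proof (induction k)
  case (Suc k)
  then show ?case by (simp add: sat_dvd_form atLeastAtMostSuc_conv) blast
qed simp

lemma fvars_dvd_none: "fvars (dvd_none z k) \<subseteq> {..k}"
  by (induction k) (auto simp: fvars_dvd_form)

lemma (in cring) finprod_divides:
  assumes "finite A" "a \<in> A" "f \<in> A \<rightarrow> carrier R"
  shows "f a divides finprod R f A"
proof (rule dividesI)
  have "f \<in> A - {a} \<rightarrow> carrier R" using assms(3) by auto
  then show "finprod R f (A - {a}) \<in> carrier R" by simp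
  have "finprod R f (insert a (A - {a})) = f a \<otimes> finprod R f (A - {a})"
    using assms \<open>f \<in> A - {a} \<rightarrow> carrier R\<close> by (intro finprod_insert) auto
  then show "finprod R f A = f a \<otimes> finprod R f (A - {a})"
    using assms(2) by (simp add: insert_absorb)
qed

section \<open>Orthogonal families and minimal covers modulo a radical ideal\<close>

locale cring_radical = cring R for R :: "'a ring" (structure) +
  fixes I
  assumes rad: "radical_ideal I R"
begin

sublocale ideal I R
  using rad by (simp add: radical_ideal_def)

text \<open>The only form in which radicality enters the later arguments.\<close>

lemma square_memD:
  assumes "x \<in> carrier R" "x \<otimes> x \<in> I"
  shows "x \<in> I"
proof -
  have "x [^] (2::nat) \<in> I" using assms by (simp add: numeral_2_eq_2)
  then have "x \<in> radical R I"
    using assms(1) by (auto simp: radical_def intro!: exI[of _ 2])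
  then show ?thesis using rad by (simp add: radical_ideal_def)
qed

lemma add_mem_cancel:
  assumes "x \<oplus> y \<in> I" "y \<in> I" "x \<in> carrier R"
  shows "x \<in> I"
proof -
  have "x = (x \<oplus> y) \<oplus> \<ominus> y" using assms(2,3) Icarr by (simp add: a_assoc r_neg)
  also have "\<dots> \<in> I"
    using assms by (simp add: additive_subgroup.a_closed[OF additive_subgroup_axioms]
        additive_subgroup.a_inv_closed[OF additive_subgroup_axioms])
  finally show ?thesis .
qed

lemma divides_notin:
  assumes "x divides b" "b \<notin> I" "x \<in> carrier R"
  shows "x \<notin> I"
  using assms I_r_closed by (auto simp: factor_def)

text \<open>Multiplication by \<open>b\<close> is the test: it sends \<open>d b\<close> into
  \<open>I\<close>, but sends no product of elements \<open>d c\<close> with \<open>c\<close> in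
  \<open>B - {b}\<close> into \<open>I\<close>.\<close>

lemma orthogonal_shattered:
  assumes fin: "finite B" and B: "B \<subseteq> carrier R - I"
    and orth: "\<And>b c. b \<in> B \<Longrightarrow> c \<in> B \<Longrightarrow> b \<noteq> c \<Longrightarrow> b \<otimes> c \<in> I"
  shows "\<exists>A. finite A \<and> card A = card B \<and> shatters R (dvd_form 2 0 1) 1 1 A"
proof -
  define d where "d b = (\<Oplus>c\<in>B - {b}. c)" for b
  have BR: "b \<in> carrier R" if "b \<in> B" for b using B that by auto
  have d_closed: "d b \<in> carrier R" for b
    unfolding d_def by (rule finsum_closed) (use BR in auto)
  have sum_mem: "b \<otimes> (\<Oplus>c\<in>C. c) \<in> I" if "b \<in> B" "C \<subseteq> B - {b}" for b C
  proof -
    have "finite C" using that fin by (meson finite_Diff finite_subset)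
    then show ?thesis using that(2)
    proof (induction C)
      case empty
      then show ?case using that BR by simp
    next
      case (insert c C)
      have c: "(\<lambda>c. c) \<in> C \<rightarrow> carrier R" "c \<in> carrier R" "b \<in> carrier R"
        using insert.prems BR that by auto
      then have "b \<otimes> (\<Oplus>c\<in>insert c C. c) = b \<otimes> c \<oplus> b \<otimes> (\<Oplus>c\<in>C. c)"
        using insert.hyps by (simp add: r_distr)
      moreover have "b \<otimes> c \<in> I" using orth insert.prems that by auto
      ultimately show ?case using insert by simp
    qed
  qed
  have step: "b \<otimes> (d c \<otimes> x) \<notin> I"
    if bc: "b \<in> B" "c \<in> B" "b \<noteq> c" and x: "x \<in> carrier R" "b \<otimes> x \<notin> I" for b c x
  proof
    assume asm: "b \<otimes> (d c \<otimes> x) \<in> I"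
    define s where "s = (\<Oplus>e\<in>B - {b, c}. e)"
    have s: "s \<in> carrier R" unfolding s_def by (rule finsum_closed) (use BR in auto)
    have b: "b \<in> carrier R" using BR bc by auto
    have "d c = (\<Oplus>e\<in>insert b (B - {b, c}). e)"
      unfolding d_def using bc by (intro arg_cong[of _ _ "finsum R (\<lambda>e. e)"]) auto
    \<comment> \<open>Since \<open>b \<otimes> s\<close> lies in \<open>I\<close>, multiplying by
      \<open>b\<close> makes \<open>d c\<close> act like \<open>b\<close> modulo
      \<open>I\<close>.\<close>
    also have "\<dots> = b \<oplus> s"
      unfolding s_def by (rule finsum_insert) (use fin BR bc in auto)
    finally have eq: "b \<otimes> (d c \<otimes> x) = b \<otimes> b \<otimes> x \<oplus> (b \<otimes> s) \<otimes> x"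
      using b s x(1) by (simp add: l_distr r_distr m_assoc)
    have "(b \<otimes> s) \<otimes> x \<in> I"
      unfolding s_def using sum_mem[OF bc(1), of "B - {b, c}"] x(1) I_r_closed by auto
    then have "b \<otimes> b \<otimes> x \<in> I"
      using add_mem_cancel[of "b \<otimes> b \<otimes> x" "b \<otimes> s \<otimes> x"] asm b x(1) unfolding eq by simp
    \<comment> \<open>The extra factor \<open>x\<close> completes the square of
      \<open>b \<otimes> x\<close>.\<close>
    then have "x \<otimes> (b \<otimes> b \<otimes> x) \<in> I" using x(1) I_l_closed by auto
    also have "x \<otimes> (b \<otimes> b \<otimes> x) = (b \<otimes> x) \<otimes> (b \<otimes> x)"
      using b x(1) by (simp add: m_ac)
    finally show False using square_memD[of "b \<otimes> x"] b x by auto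
  qed
  have key: "d b divides finprod R d C \<longleftrightarrow> b \<in> C" if b: "b \<in> B" and C: "C \<subseteq> B" for b C
  proof
    have "finite C" using C fin finite_subset by auto
    then show "d b divides finprod R d C" if "b \<in> C"
      using that d_closed by (intro finprod_divides) auto
    show "b \<in> C" if div: "d b divides finprod R d C"
    proof (rule ccontr)
      assume "b \<notin> C"
      \<comment> \<open>Starting from \<open>b\<close> outside \<open>I\<close>, each factor
        \<open>d c\<close> has \<open>c \<noteq> b\<close>, so \<open>step\<close> applies.\<close>
      have "b \<otimes> finprod R d C' \<notin> I" if "C' \<subseteq> C" for C'
      proof -
        have "finite C'" using that \<open>finite C\<close> finite_subset by auto
        then show ?thesis using that
        proof (induction C')
          case empty
          then show ?case using b B by auto
        next
          case (insert c C')
          then have "finprod R d (insert c C') = d c \<otimes> finprod R d C'"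
            using d_closed by (intro finprod_insert) auto
          moreover have "finprod R d C' \<in> carrier R" using d_closed by (intro finprod_closed) auto
          ultimately show ?case using step[of b c] insert b C \<open>b \<notin> C\<close> by auto
        qed
      qed
      moreover have "b \<otimes> finprod R d C \<in> I"
      proof -
        obtain z where z: "z \<in> carrier R" "finprod R d C = d b \<otimes> z"
          using div by (auto simp: factor_def)
        have "(b \<otimes> d b) \<otimes> z \<in> I"
          using sum_mem[OF b order_refl] z(1) I_r_closed by (simp add: d_def)
        then show ?thesis using z b BR d_closed by (simp add: m_assoc)
      qed
      ultimately show False by blast
    qed
  qed
  \<comment> \<open>If \<open>d b = d c\<close>, then \<open>d b\<close> divides the one-factor
    product over \<open>{c}\<close>, so \<open>key\<close> gives \<open>b = c\<close>. Hence the
    shattered set has full size.\<close>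
  have inj: "b = c" if "b \<in> B" "c \<in> B" "d b = d c" for b c
    using key[of b "{c}"] that d_closed by simp
  define A where "A = (\<lambda>b. [d b]) ` B"
  have "card A = card B"
    unfolding A_def by (rule card_image) (auto intro!: inj_onI inj)
  moreover have "shatters R (dvd_form 2 0 1) 1 1 A"
    unfolding shatters_def
  proof (intro conjI allI impI)
    show "A \<subseteq> tuples (carrier R) 1" using d_closed by (auto simp: A_def tuples_def)
  next
    fix A' assume "A' \<subseteq> A"
    \<comment> \<open>The subset \<open>A'\<close> is coded by the product of \<open>d\<close> over
      \<open>C\<close>.\<close>
    define C where "C = {b \<in> B. [d b] \<in> A'}"
    have "sat R ((!) ([d b] @ [finprod R d C])) (dvd_form 2 0 1) \<longleftrightarrow> [d b] \<in> A'" if "b \<in> B" for b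
      using key[OF that, of C] that by (simp add: sat_dvd_form) (auto simp: C_def)
    moreover have "[finprod R d C] \<in> tuples (carrier R) 1"
      using d_closed by (simp add: tuples_def)
    ultimately show "\<exists>e\<in>tuples (carrier R) 1. \<forall>a\<in>A. sat R ((!) (a @ e)) (dvd_form 2 0 1) \<longleftrightarrow> a \<in> A'"
      unfolding A_def by blast
  qed
  ultimately show ?thesis using fin by (auto simp: A_def)
qed

lemma minimal_cover_orthogonal:
  assumes "finite F" "F \<subseteq> carrier R - I"
  obtains B where "finite B" "B \<subseteq> carrier R - I" "\<And>x. x \<in> F \<Longrightarrow> \<exists>b\<in>B. x divides b"
    "\<And>b c. b \<in> B \<Longrightarrow> c \<in> B \<Longrightarrow> b \<noteq> c \<Longrightarrow> b \<otimes> c \<in> I"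
proof -
  define P where "P B \<longleftrightarrow> finite B \<and> B \<subseteq> carrier R - I \<and> (\<forall>x\<in>F. \<exists>b\<in>B. x divides b)" for B
  have "P F" using assms by (auto simp: P_def)
  then obtain B where B: "P B" and min: "\<And>B'. P B' \<Longrightarrow> card B \<le> card B'"
    using ex_has_least_nat[of P F card] by blast
  have "b \<otimes> c \<in> I" if bc: "b \<in> B" "c \<in> B" "b \<noteq> c" for b c
  proof (rule ccontr)
    assume notin: "b \<otimes> c \<notin> I"
    \<comment> \<open>Both \<open>b\<close> and \<open>c\<close> divide their product, so by
      transitivity the merged set still covers \<open>F\<close>, with fewer elements.\<close>
    define B' where "B' = insert (b \<otimes> c) (B - {b, c})"
    have carr: "b \<in> carrier R" "c \<in> carrier R" using B bc by (auto simp: P_def)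
    have dv: "b divides b \<otimes> c" "c divides b \<otimes> c"
      using carr m_comm by (auto simp: factor_def)
    have "\<exists>e\<in>B'. x divides e" if x: "x \<in> F" for x
    proof -
      obtain e where e: "e \<in> B" "x divides e" using B x unfolding P_def by blast
      have "x \<in> carrier R" using x assms by auto
      then show ?thesis
        using e dv divides_trans[of x e "b \<otimes> c"] by (cases "e \<in> {b, c}") (auto simp: B'_def)
    qed
    then have "P B'" using B notin carr by (auto simp: P_def B'_def)
    moreover have "card B' < card B"
    proof -
      have "finite B" using B by (simp add: P_def)
      then have "card (B - {b, c}) = card B - 2" "card B \<ge> 2"
        using bc by (simp_all add: card_Diff_subset) (metis card_2_iff card_mono empty_subsetI insert_subset)
      moreover have "card B' \<le> Suc (card (B - {b, c}))"
        unfolding B'_def by (rule card_insert_le_m1) auto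
      ultimately show ?thesis by linarith
    qed
    ultimately show False using min by fastforce
  qed
  with B show thesis using that by (auto simp: P_def)
qed

end

section \<open>From NIP to a uniform number of external parameters\<close>

theorem theorem2p13:
  fixes R :: "'a ring" and I :: "'a set"
  assumes "cring R"
    and "NIP_ring R"
    and "radical_ideal I R"
  shows "externally_definable R 1 ((\<lambda>x. [x]) ` I)"
proof -
  interpret cring R by fact
  interpret cring_radical R I by unfold_locales fact
  \<comment> \<open>As \<open>R\<close> models its own theory, failure of IP forbids a shattered set
    of some size \<open>k\<close> in \<open>R\<close> itself.\<close>
  have "ring_model R (complete_theory R)"
    using \<open>cring R\<close> by (simp add: ring_model_def complete_theory_def)
  moreover have "\<not> has_IP TYPE('a) (complete_theory R) (dvd_form 2 0 1) 1 1"
    using \<open>NIP_ring R\<close> by (auto simp: NIP_ring_def NIP_theory_def fvars_dvd_form)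
  ultimately obtain k where k: "\<And>A. finite A \<Longrightarrow> card A = k \<Longrightarrow> \<not> shatters R (dvd_form 2 0 1) 1 1 A"
    unfolding has_IP_def by blast
  have bound: "card B < k" if "finite B" "B \<subseteq> carrier R - I"
    "\<And>b c. b \<in> B \<Longrightarrow> c \<in> B \<Longrightarrow> b \<noteq> c \<Longrightarrow> b \<otimes>\<^bsub>R\<^esub> c \<in> I" for B
  proof (rule ccontr)
    assume "\<not> card B < k"
    \<comment> \<open>Only size exactly \<open>k\<close> is excluded, so a larger family is cut down
      to \<open>k\<close> elements; orthogonality is inherited.\<close>
    then obtain B' where "B' \<subseteq> B" "card B' = k" "finite B'"
      by (meson not_less obtain_subset_with_card_n)
    then show False
      using orthogonal_shattered[of B'] k that by (metis subset_iff order_trans)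
  qed
  have "\<exists>m. \<forall>X. finite X \<longrightarrow> X \<subseteq> carrier R \<longrightarrow> (\<exists>b\<in>tuples (carrier R) m.
      \<forall>x\<in>X. (\<forall>e\<in>set b. \<not> x divides\<^bsub>R\<^esub> e) \<longleftrightarrow> x \<in> I)"
  proof (cases "I = carrier R")
    case True
    then show ?thesis by (intro exI[of _ 0]) (auto simp: tuples_def)
  next
    case False
    then have "\<one>\<^bsub>R\<^esub> \<notin> I" using one_imp_carrier by auto
    have "\<exists>b\<in>tuples (carrier R) k. \<forall>x\<in>X. (\<forall>e\<in>set b. \<not> x divides\<^bsub>R\<^esub> e) \<longleftrightarrow> x \<in> I"
      if X: "finite X" "X \<subseteq> carrier R" for X
    proof -
      obtain B where B: "finite B" "B \<subseteq> carrier R - I" "\<And>x. x \<in> X - I \<Longrightarrow> \<exists>b\<in>B. x divides\<^bsub>R\<^esub> b"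
        "card B < k"
        using minimal_cover_orthogonal[of "X - I"] X bound by (metis Diff_mono finite_Diff order_refl)
      obtain bs where bs: "set bs = B" "length bs = card B"
        using finite_distinct_list[OF B(1)] distinct_card by metis
      \<comment> \<open>Padding with one fixes the length at \<open>k\<close>. It is harmless
        because \<open>I\<close> is proper, so no element of \<open>I\<close> divides one.\<close>
      define b where "b = bs @ replicate (k - card B) \<one>\<^bsub>R\<^esub>"
      have b: "set b = insert \<one>\<^bsub>R\<^esub> B" using bs B(4) by (simp add: b_def)
      have "b \<in> tuples (carrier R) k"
        using b bs B(2,4) by (auto simp: tuples_def b_def)
      moreover have "(\<forall>e\<in>set b. \<not> x divides\<^bsub>R\<^esub> e) \<longleftrightarrow> x \<in> I" if "x \<in> X" for x
      proof
        assume "x \<in> I"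
        then have "\<not> x divides\<^bsub>R\<^esub> e" if "e \<notin> I" for e
          using divides_notin[of x e] that Icarr by auto
        then show "\<forall>e\<in>set b. \<not> x divides\<^bsub>R\<^esub> e"
          using b B(2) \<open>\<one>\<^bsub>R\<^esub> \<notin> I\<close> by auto
      qed (use B(3) that b in auto)
      ultimately show ?thesis by blast
    qed
    then show ?thesis by blast
  qed
  then obtain m where m: "\<And>X. finite X \<Longrightarrow> X \<subseteq> carrier R \<Longrightarrow> \<exists>b\<in>tuples (carrier R) m.
      \<forall>x\<in>X. (\<forall>e\<in>set b. \<not> x divides\<^bsub>R\<^esub> e) \<longleftrightarrow> x \<in> I"
    by blast
  show ?thesis
  \<comment> \<open>Variable \<open>Suc m\<close> is the first one beyond the tested element and the
    \<open>m\<close> parameters, hence free for the bound cofactor.\<close>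
  proof (rule externally_definableI[where m = m and f = "dvd_none (Suc m) m"])
    show "fvars (dvd_none (Suc m) m) \<subseteq> {..<1 + m}"
      using fvars_dvd_none[of "Suc m" m] by auto
    show "(\<lambda>x. [x]) ` I \<subseteq> tuples (carrier R) 1"
      using Icarr by (auto simp: tuples_def)
    fix X assume X: "finite X" "X \<subseteq> carrier R"
    obtain b where b: "b \<in> tuples (carrier R) m"
      "\<And>x. x \<in> X \<Longrightarrow> (\<forall>e\<in>set b. \<not> x divides\<^bsub>R\<^esub> e) \<longleftrightarrow> x \<in> I"
      using m[OF X] by blast
    have "sat R ((!) (a @ b)) (dvd_none (Suc m) m) \<longleftrightarrow> a \<in> (\<lambda>x. [x]) ` I" if a: "a \<in> tuples X 1" for a
    proof -
      obtain x where x: "a = [x]" "x \<in> X"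
        using a by (auto simp: tuples_def length_Suc_conv)
      have "length b = m" using b(1) by (simp add: tuples_def)
      \<comment> \<open>The tested element occupies position 0, which shifts the entries of
        \<open>b\<close> to positions 1 to \<open>m\<close>.\<close>
      then have "set b = (\<lambda>j. (a @ b) ! j) ` {1..m}"
        by (force simp: x(1) set_conv_nth image_def Suc_le_eq gr0_conv_Suc)
      then have "sat R ((!) (a @ b)) (dvd_none (Suc m) m) \<longleftrightarrow> (\<forall>e\<in>set b. \<not> x divides\<^bsub>R\<^esub> e)"
        by (simp add: sat_dvd_none x(1))
      then show ?thesis using b(2)[OF x(2)] x(1) by auto
    qed
    then show "\<exists>b\<in>tuples (carrier R) m. \<forall>a\<in>tuples X 1.
        sat R ((!) (a @ b)) (dvd_none (Suc m) m) \<longleftrightarrow> a \<in> (\<lambda>x. [x]) ` I"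
      using b(1) by blast
  qed fact
qed

end
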